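(* Let $n,r \in \mathbb{N}$ with $r \geqslant 3$. Then $m(n,r,2,1) \geqslant \frac{4n}{r+1}$.
   Context: An $r$-colouring of the complete graph $K_n$ ($n \geqslant 2$) is any function $f: E(K_n) \to [r] = \{1,\dots,r\}$. For a subgraph $H \subseteq K_n$, $c_f(H) = |f(E(H))|$ is the number of distinct colours on edges of $H$. A graph on at least $k+1$ vertices is $k$-connected if deleting any at most $k-1$ vertices leaves a connected graph. $M(f,n,r,s,k)$ is the maximum number of vertices of a $k$-connected subgraph $H \subseteq K_n$ with $c_f(H) \leqslant s$ (taken to be $0$ if no such subgraph exists), and $m(n,r,s,k) = \min_f M(f,n,r,s,k)$, the minimum over all $r$-colourings $f$ of $E(K_n)$. *)

theory Defs
  imports Complex_Main "HOL-Library.FuncSet"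
begin

text \<open>
  Undirected simple graphs are given by a vertex set \<open>V\<close> and a set \<open>E\<close> of two-element
  subsets of \<open>V\<close>. The complete graph \<open>K\<^sub>n\<close> has vertex set \<open>{1..n}\<close>.
\<close>

definition all_edges :: "'a set \<Rightarrow> 'a set set" where
  "all_edges V = {e. e \<subseteq> V \<and> card e = 2}"

definition subgraph_of_complete :: "nat \<Rightarrow> nat set \<Rightarrow> nat set set \<Rightarrow> bool" where
  "subgraph_of_complete n V E \<longleftrightarrow> V \<subseteq> {1..n} \<and> E \<subseteq> all_edges V"

definition graph_connected :: "'a set \<Rightarrow> 'a set set \<Rightarrow> bool" where
  "graph_connected V E \<longleftrightarrow> (\<forall>u\<in>V. \<forall>v\<in>V. (u, v) \<in> {(x, y). {x, y} \<in> E}\<^sup>*)"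

text \<open>
  ``At most \<open>k - 1\<close> vertices'' is written \<open>card S < k\<close> to avoid truncated subtraction.
\<close>

definition k_connected :: "nat \<Rightarrow> 'a set \<Rightarrow> 'a set set \<Rightarrow> bool" where
  "k_connected k V E \<longleftrightarrow>
     finite V \<and> card V \<ge> k + 1 \<and>
     (\<forall>S. S \<subseteq> V \<and> card S < k \<longrightarrow> graph_connected (V - S) {e \<in> E. e \<inter> S = {}})"

text \<open>
  Colourings need not use every colour. They are taken extensional (undefined off the edges
  of \<open>K\<^sub>n\<close>), so that there are only finitely many of them.
\<close>

definition colourings :: "nat \<Rightarrow> nat \<Rightarrow> (nat set \<Rightarrow> nat) set" where
  "colourings n r = all_edges {1..n} \<rightarrow>\<^sub>E {1..r}"

definition num_colours :: "('a set \<Rightarrow> nat) \<Rightarrow> 'a set set \<Rightarrow> nat" where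
  "num_colours f E = card (f ` E)"

text \<open>
  \<open>max_order f n s k\<close> is \<open>M(f, n, r, s, k)\<close>, which depends on \<open>r\<close> only through \<open>f\<close>; inserting
  \<open>0\<close> covers the case in which no suitable subgraph exists. \<open>min_max_order n r s k\<close> is
  \<open>m(n, r, s, k)\<close>.
\<close>

definition max_order :: "(nat set \<Rightarrow> nat) \<Rightarrow> nat \<Rightarrow> nat \<Rightarrow> nat \<Rightarrow> nat" where
  "max_order f n s k =
     Max (insert 0 {card V | V E.
       subgraph_of_complete n V E \<and> k_connected k V E \<and> num_colours f E \<le> s})"

definition min_max_order :: "nat \<Rightarrow> nat \<Rightarrow> nat \<Rightarrow> nat \<Rightarrow> nat" where
  "min_max_order n r s k = Min ((\<lambda>f. max_order f n s k) ` colourings n r)"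

end

theory Submission
  imports Defs
begin

text \<open>
  Let \<open>A\<close> be a largest monochromatic component, say of colour \<open>i\<close>, and let \<open>a = card A\<close>. For every
  colour \<open>j \<noteq> i\<close>, the union \<open>U\<^sub>j\<close> of the \<open>j\<close>-components meeting \<open>A\<close> is connected in the
  colours \<open>i, j\<close> and contains \<open>A\<close>; let \<open>M\<close> be the largest order of a two-coloured component.

  If \<open>(r + 1) a \<le> 2 n\<close>, count the pairs in \<open>A \<times> (V - A)\<close>: those of colour \<open>j\<close> lie in products
  \<open>(C \<inter> A) \<times> (C - A)\<close> with \<open>C\<close> a \<open>j\<close>-component, and
  \<open>4 |C \<inter> A| |C - A| \<le> |C|\<^sup>2 \<le> a |C|\<close>, so that \<open>4 a (n - a) \<le> (r - 1) a M\<close>.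
  If \<open>(r + 1) a \<ge> 2 n\<close>, use that every vertex outside \<open>A\<close> lies in at least two of the \<open>U\<^sub>j\<close>:
  were all its edges to \<open>A\<close> of one colour, it would form with \<open>A\<close> part of a larger
  monochromatic component. Hence \<open>2 (n - a) \<le> (r - 1) (M - a)\<close>.
\<close>

section \<open>Components with respect to a set of colours\<close>

definition colour_rel :: "'a set \<Rightarrow> ('a set \<Rightarrow> 'c) \<Rightarrow> 'c set \<Rightarrow> ('a \<times> 'a) set" where
  "colour_rel V f I = {(x, y). {x, y} \<in> all_edges V \<and> f {x, y} \<in> I}"

text \<open>Taking a set \<open>I\<close> of colours makes monochromatic and two-coloured components
  instances of one notion. A vertex on no edge coloured from \<open>I\<close> forms a component by
  itself.\<close>

definition colour_comp :: "'a set \<Rightarrow> ('a set \<Rightarrow> 'c) \<Rightarrow> 'c set \<Rightarrow> 'a \<Rightarrow> 'a set" where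
  "colour_comp V f I u = (colour_rel V f I)\<^sup>* `` {u}"

lemma edge_in_all_edges: "x \<in> V \<Longrightarrow> y \<in> V \<Longrightarrow> x \<noteq> y \<Longrightarrow> {x, y} \<in> all_edges V"
  by (simp add: all_edges_def)

lemma finite_all_edges: "finite V \<Longrightarrow> finite (all_edges V)"
  unfolding all_edges_def by (rule finite_subset[of _ "Pow V"]) auto

lemma colour_comp_refl [simp]: "u \<in> colour_comp V f I u"
  by (simp add: colour_comp_def)

lemma colour_comp_subset:
  assumes "u \<in> V"
  shows "colour_comp V f I u \<subseteq> V"
proof
  fix w assume "w \<in> colour_comp V f I u"
  then have "(u, w) \<in> (colour_rel V f I)\<^sup>*"
    by (simp add: colour_comp_def)
  then show "w \<in> V"
    by (induction rule: rtrancl_induct) (auto simp: assms colour_rel_def all_edges_def)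
qed

text \<open>Edges are undirected, so reachability is an equivalence relation and components are its
  classes.\<close>

lemma colour_comp_eq:
  assumes "w \<in> colour_comp V f I u"
  shows "colour_comp V f I w = colour_comp V f I u"
proof -
  have "sym (colour_rel V f I)"
    by (auto simp: sym_def colour_rel_def insert_commute)
  then have "sym ((colour_rel V f I)\<^sup>*)"
    by (rule sym_rtrancl)
  then have "(w, u) \<in> (colour_rel V f I)\<^sup>*" "(u, w) \<in> (colour_rel V f I)\<^sup>*"
    using assms by (auto simp: colour_comp_def dest: symD)
  then show ?thesis
    by (auto simp: colour_comp_def intro: rtrancl_trans)
qed

lemma colour_comp_mono: "I \<subseteq> J \<Longrightarrow> colour_comp V f I u \<subseteq> colour_comp V f J u"
  unfolding colour_comp_def
  by (intro Image_mono rtrancl_mono) (auto simp: colour_rel_def)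

lemma edge_in_colour_comp:
  assumes "u \<in> V" "v \<in> V" "u \<noteq> v" "f {u, v} \<in> I"
  shows "v \<in> colour_comp V f I u"
  using edge_in_all_edges[OF assms(1-3)] assms(4)
  by (auto simp: colour_comp_def colour_rel_def)

text \<open>A path starting in \<open>W\<close> never leaves \<open>W\<close>, so all its edges
  survive the restriction to \<open>all_edges W\<close>.\<close>

lemma graph_connected_colour_comp:
  fixes f :: "'a set \<Rightarrow> 'c" and I :: "'c set"
  assumes "u \<in> V"
  defines "W \<equiv> colour_comp V f I u"
  shows "graph_connected W {e \<in> all_edges W. f e \<in> I}"
  unfolding graph_connected_def
proof (intro ballI)
  fix x y assume x: "x \<in> W" and "y \<in> W"
  then have W: "W = colour_comp V f I x"
    using colour_comp_eq unfolding W_def by metis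
  with \<open>y \<in> W\<close> have "(x, y) \<in> (colour_rel V f I)\<^sup>*"
    by (simp add: colour_comp_def)
  then show "(x, y) \<in> {(x, y). {x, y} \<in> {e \<in> all_edges W. f e \<in> I}}\<^sup>*"
  proof (induction rule: rtrancl_induct)
    case base
    show ?case by simp
  next
    case (step y z)
    have "y \<in> W" "z \<in> W"
      using step.hyps by (auto simp: W colour_comp_def intro: rtrancl_into_rtrancl)
    then have "{y, z} \<in> all_edges W" "f {y, z} \<in> I"
      using step.hyps by (auto simp: colour_rel_def all_edges_def)
    with step.IH show ?case
      by (auto intro: rtrancl_into_rtrancl)
  qed
qed

text \<open>Only \<open>S = {}\<close> can be deleted; finiteness of \<open>V\<close> excludes
  infinite \<open>S\<close>, whose \<open>card\<close> is 0.\<close>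

lemma k_connected_1_iff:
  "k_connected 1 V E \<longleftrightarrow> finite V \<and> card V \<ge> 2 \<and> graph_connected V E"
proof -
  have "S \<subseteq> V \<and> card S < 1 \<longleftrightarrow> S = {}" if "finite V" for S
    using that by (auto dest: finite_subset)
  then have "finite V \<Longrightarrow>
      (\<forall>S. S \<subseteq> V \<and> card S < 1 \<longrightarrow> graph_connected (V - S) {e \<in> E. e \<inter> S = {}})
      \<longleftrightarrow> graph_connected V E"
    by simp
  then show ?thesis
    unfolding k_connected_def one_add_one by blast
qed

section \<open>The bound for two-coloured components\<close>

lemma two_coloured_component_bound:
  fixes f :: "'a set \<Rightarrow> 'c"
  assumes fin: "finite V" "finite K" and ne: "V \<noteq> {}" and r: "card K \<ge> 3"
    and f: "\<And>e. e \<in> all_edges V \<Longrightarrow> f e \<in> K"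
    and M: "\<And>I u. I \<subseteq> K \<Longrightarrow> card I = 2 \<Longrightarrow> u \<in> V \<Longrightarrow> card (colour_comp V f I u) \<le> M"
  shows "4 * card V \<le> (card K + 1) * M"
proof -
  \<comment> \<open>One maximum over pairs of a colour and a vertex makes \<open>A\<close> largest
    among the components of all colours.\<close>
  define g where "g = (\<lambda>(j, u). card (colour_comp V f {j} u))"
  have K1: "1 \<le> card K" and "K \<noteq> {}" using r by auto
  then have KV: "finite (K \<times> V)" "K \<times> V \<noteq> {}" using fin ne by auto
  then have "Max (g ` (K \<times> V)) \<in> g ` (K \<times> V)"
    by (intro Max_in) auto
  then obtain i u0 where iu: "i \<in> K" "u0 \<in> V" and gmax: "g (i, u0) = Max (g ` (K \<times> V))"
    by auto
  define A where "A = colour_comp V f {i} u0"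
  have amax: "card (colour_comp V f {j} u) \<le> card A" if "j \<in> K" "u \<in> V" for j u
  proof -
    have "g (j, u) \<le> g (i, u0)"
      unfolding gmax using KV that by (intro Max_ge) auto
    then show ?thesis by (simp add: g_def A_def)
  qed
  have AV: "A \<subseteq> V" and u0A: "u0 \<in> A"
    using colour_comp_subset[OF iu(2)] by (auto simp: A_def)
  have finA: "finite A" using AV fin(1) finite_subset by blast
  have Apos: "card A > 0" using u0A finA card_gt_0_iff by blast
  have cardVA: "card (V - A) = card V - card A" and aV: "card A \<le> card V"
    using AV fin(1) by (auto simp: card_Diff_subset finA card_mono)
  have finC: "finite (colour_comp V f I u)" if "u \<in> V" for I u
    using that fin(1) colour_comp_subset finite_subset by metis

  define J where "J = K - {i}"
  have finJ: "finite J" and cardJ: "card J = card K - 1"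
    using fin iu by (auto simp: J_def)
  \<comment> \<open>As an image, \<open>P j\<close> contains each \<open>j\<close>-component meeting
    \<open>A\<close> once, however many vertices of \<open>A\<close> lie in it.\<close>
  define P where "P j = colour_comp V f {j} ` A" for j
  define U where "U j = \<Union>(P j)" for j
  have AU: "A \<subseteq> U j" for j
    unfolding U_def P_def by (blast intro: colour_comp_refl)
  have UV: "U j \<subseteq> V" for j
    unfolding U_def P_def using AV by (intro UN_least colour_comp_subset) auto
  have finU: "finite (U j)" for j
    using UV fin(1) finite_subset by blast
  have cardU: "card (U j) \<le> M" if "j \<in> J" for j
  proof -
    have "U j \<subseteq> colour_comp V f {i, j} u0"
    proof
      fix w assume "w \<in> U j"
      then obtain u where u: "u \<in> A" "w \<in> colour_comp V f {j} u"
        by (auto simp: U_def P_def)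
      have "u \<in> colour_comp V f {i, j} u0" "w \<in> colour_comp V f {i, j} u"
        using u colour_comp_mono[of "{i}" "{i, j}" V f u0] colour_comp_mono[of "{j}" "{i, j}" V f u]
        by (auto simp: A_def)
      then show "w \<in> colour_comp V f {i, j} u0"
        using colour_comp_eq by metis
    qed
    then have "card (U j) \<le> card (colour_comp V f {i, j} u0)"
      by (intro card_mono finC iu)
    also have "\<dots> \<le> M"
      using that iu by (intro M) (auto simp: J_def)
    finally show ?thesis .
  qed
  \<comment> \<open>An edge leaving \<open>A\<close> cannot have colour \<open>i\<close>, since
    \<open>A\<close> is a full \<open>i\<close>-component.\<close>
  have crossing: "f {u, v} \<in> J \<and> v \<in> colour_comp V f {f {u, v}} u"
    if "u \<in> A" "v \<in> V - A" for u v
  proof -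
    have uv: "u \<in> V" "v \<in> V" "u \<noteq> v" using that AV by auto
    have v: "v \<in> colour_comp V f {f {u, v}} u"
      using uv by (intro edge_in_colour_comp) auto
    moreover have "f {u, v} \<noteq> i"
      using v that colour_comp_eq[of u V f "{i}" u0] by (auto simp: A_def)
    ultimately show ?thesis
      using f[OF edge_in_all_edges[OF uv]] by (simp add: J_def)
  qed

  show ?thesis
  \<comment> \<open>The two lower bounds for \<open>M\<close> are decreasing and nondecreasing in
    \<open>card A\<close>, respectively; both equal the claimed value when
    \<open>(card K + 1) * card A = 2 * card V\<close>.\<close>
  proof (cases "(card K + 1) * card A \<le> 2 * card V")
    case True
    have "A \<times> (V - A) \<subseteq> (\<Union>j\<in>J. \<Union>C\<in>P j. (C \<inter> A) \<times> (C - A))"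
    proof clarsimp
      fix u v assume uv: "u \<in> A" "v \<in> V" "v \<notin> A"
      then show "\<exists>j\<in>J. \<exists>C\<in>P j. u \<in> C \<and> v \<in> C"
        using crossing[of u v]
        by (intro bexI[of _ "f {u, v}"] bexI[of _ "colour_comp V f {f {u, v}} u"])
          (auto simp: P_def)
    qed
    moreover have finP: "finite (P j)" for j
      using finA by (simp add: P_def)
    moreover have finCP: "finite C" if "C \<in> P j" for C j
      using that AV finC by (auto simp: P_def)
    ultimately have "card (A \<times> (V - A)) \<le> card (\<Union>j\<in>J. \<Union>C\<in>P j. (C \<inter> A) \<times> (C - A))"
      using finJ by (intro card_mono) auto
    also have "\<dots> \<le> (\<Sum>j\<in>J. card (\<Union>C\<in>P j. (C \<inter> A) \<times> (C - A)))"
      by (rule card_UN_le[OF finJ])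
    also have "\<dots> \<le> (\<Sum>j\<in>J. \<Sum>C\<in>P j. card ((C \<inter> A) \<times> (C - A)))"
      by (intro sum_mono card_UN_le finP)
    finally have "4 * card (A \<times> (V - A)) \<le> (\<Sum>j\<in>J. \<Sum>C\<in>P j. 4 * card ((C \<inter> A) \<times> (C - A)))"
      by (simp flip: sum_distrib_left)
    also have "\<dots> \<le> (\<Sum>j\<in>J. \<Sum>C\<in>P j. card A * card C)"
    proof (intro sum_mono)
      fix j C assume j: "j \<in> J" and C: "C \<in> P j"
      have split: "card C = card (C \<inter> A) + card (C - A)"
        using card_Int_Diff[OF finCP[OF C]] .
      have CA: "card C \<le> card A"
        using C j AV amax by (auto simp: P_def J_def)
      have "4 * (x * y) \<le> (x + y) * (x + y)" for x y :: nat
      proof -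
        have "0 \<le> (int x - int y)\<^sup>2" by simp
        then have "int (4 * (x * y)) \<le> int ((x + y) * (x + y))"
          by (simp add: power2_eq_square algebra_simps)
        then show ?thesis by linarith
      qed
      then have "4 * card ((C \<inter> A) \<times> (C - A)) \<le> card C * card C"
        by (simp add: split card_cartesian_product)
      also have "\<dots> \<le> card A * card C"
        using CA by simp
      finally show "4 * card ((C \<inter> A) \<times> (C - A)) \<le> card A * card C" .
    qed
    also have "\<dots> = (\<Sum>j\<in>J. card A * card (U j))"
    proof (intro sum.cong refl)
      fix j
      \<comment> \<open>Disjointness turns the sum of the orders of the components into
        \<open>card (U j)\<close>.\<close>
      have "C \<inter> D = {}" if "C \<in> P j" "D \<in> P j" "C \<noteq> D" for C D
      proof (rule ccontr)
        assume "C \<inter> D \<noteq> {}"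
        then obtain w where "w \<in> C" "w \<in> D" by blast
        then have "C = colour_comp V f {j} w" "D = colour_comp V f {j} w"
          using that by (auto simp: P_def dest: colour_comp_eq)
        then show False using that(3) by simp
      qed
      then have "card (U j) = (\<Sum>C\<in>P j. card C)"
        unfolding U_def using finCP
        by (intro card_Union_disjoint) (auto simp: pairwise_def disjnt_def)
      then show "(\<Sum>C\<in>P j. card A * card C) = card A * card (U j)"
        by (simp add: sum_distrib_left)
    qed
    also have "\<dots> \<le> (\<Sum>j\<in>J. card A * M)"
      using cardU by (intro sum_mono) simp
    finally have "card A * (4 * (card V - card A)) \<le> card A * ((card K - 1) * M)"
      by (simp add: card_cartesian_product cardVA cardJ algebra_simps)
    then have "4 * (card V - card A) \<le> (card K - 1) * M"
      using Apos by simp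
    then have "int (4 * (card V - card A)) \<le> int ((card K - 1) * M)"
      by (simp only: of_nat_le_iff)
    then have "4 * (int (card V) - int (card A)) \<le> (int (card K) - 1) * int M"
      by (simp only: of_nat_mult of_nat_diff[OF aV] of_nat_diff[OF K1] of_nat_1 of_nat_numeral)
    \<comment> \<open>After this multiplication the case assumption eliminates
      \<open>card A\<close>, leaving a common factor \<open>card K - 1 > 0\<close> to
      cancel.\<close>
    then have "(int (card K) + 1) * (4 * (int (card V) - int (card A)))
        \<le> (int (card K) + 1) * ((int (card K) - 1) * int M)"
      by (intro mult_left_mono) auto
    moreover have "int ((card K + 1) * card A) \<le> int (2 * card V)"
      using True by (simp only: of_nat_le_iff)
    ultimately have "(int (card K) - 1) * (4 * int (card V))
        \<le> (int (card K) - 1) * ((int (card K) + 1) * int M)"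
      by (simp add: algebra_simps)
    then have "4 * int (card V) \<le> (int (card K) + 1) * int M"
      using r by (elim mult_left_le_imp_le) simp
    then have "int (4 * card V) \<le> int ((card K + 1) * M)" by (simp add: algebra_simps)
    then show ?thesis by linarith
  next
    case False
    have two: "2 \<le> card {j \<in> J. v \<in> U j}" if v: "v \<in> V - A" for v
    proof (rule ccontr)
      assume "\<not> 2 \<le> card {j \<in> J. v \<in> U j}"
      then have le1: "card {j \<in> J. v \<in> U j} \<le> Suc 0" by simp
      \<comment> \<open>Every edge from \<open>A\<close> to \<open>v\<close> contributes its colour
        to this set; with at most one element, it forces all these edges to share a colour.\<close>
      have in_U: "f {u, v} \<in> {j \<in> J. v \<in> U j}" if "u \<in> A" for u
        using crossing[OF that v] that by (auto simp: U_def P_def)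
      define j where "j = f {u0, v}"
      have "f {u, v} = j" if "u \<in> A" for u
        using in_U[OF that] in_U[OF u0A] le1 finJ by (auto simp: card_le_Suc0_iff_eq j_def)
      then have "A \<subseteq> colour_comp V f {j} v"
        using v AV by (intro subsetI edge_in_colour_comp) (auto simp: insert_commute)
      then have "insert v A \<subseteq> colour_comp V f {j} v" by simp
      then have "card (insert v A) \<le> card (colour_comp V f {j} v)"
        using v by (intro card_mono finC) auto
      also have "\<dots> \<le> card A"
        using v in_U[OF u0A] by (intro amax) (auto simp: J_def j_def)
      finally show False using v finA by simp
    qed
    have "2 * (card V - card A) = (\<Sum>v\<in>V - A. 2)"
      by (simp add: cardVA)
    also have "\<dots> \<le> (\<Sum>v\<in>V - A. card {j \<in> J. v \<in> U j})"
      using two by (intro sum_mono) auto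
    \<comment> \<open>Double counting of the pairs \<open>(v, j)\<close> with \<open>v\<close> in
      \<open>U j - A\<close>.\<close>
    also have "\<dots> = (\<Sum>j\<in>J. card {v \<in> V - A. v \<in> U j})"
      using fin finJ by (intro sum_multicount_gen) auto
    also have "\<dots> \<le> (\<Sum>j\<in>J. M - card A)"
    proof (intro sum_mono)
      fix j assume "j \<in> J"
      have "{v \<in> V - A. v \<in> U j} = U j - A" using UV by auto
      then show "card {v \<in> V - A. v \<in> U j} \<le> M - card A"
        using cardU[OF \<open>j \<in> J\<close>] AU finA by (simp add: card_Diff_subset diff_le_mono)
    qed
    finally have bound: "2 * (card V - card A) \<le> (card K - 1) * (M - card A)"
      by (simp add: cardJ)
    have "J \<noteq> {}" using cardJ r by auto
    then have aM: "card A \<le> M"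
      using AU cardU finU card_mono le_trans by (metis all_not_in_conv)
    from bound have "int (2 * (card V - card A)) \<le> int ((card K - 1) * (M - card A))"
      by (simp only: of_nat_le_iff)
    then have "2 * (int (card V) - int (card A)) \<le> (int (card K) - 1) * (int M - int (card A))"
      by (simp only: of_nat_mult of_nat_diff[OF aV] of_nat_diff[OF K1] of_nat_diff[OF aM]
          of_nat_1 of_nat_numeral)
    then have "(int (card K) + 1) * (2 * (int (card V) - int (card A)))
        \<le> (int (card K) + 1) * ((int (card K) - 1) * (int M - int (card A)))"
      by (intro mult_left_mono) auto
    moreover have "int (2 * card V) \<le> int ((card K + 1) * card A)"
      using False by (simp only: of_nat_le_iff)
    then have "2 * int (card V) \<le> (int (card K) + 1) * int (card A)"
      by (simp add: algebra_simps)
    \<comment> \<open>In the previous product \<open>card A\<close> has net coefficient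
      \<open>(card K + 1) * (card K - 3)\<close>. It is nonnegative as
      \<open>card K \<ge> 3\<close>, so the lower bound on \<open>card A\<close> can be
      inserted.\<close>
    then have "(int (card K) - 3) * (2 * int (card V))
        \<le> (int (card K) - 3) * ((int (card K) + 1) * int (card A))"
      using r by (intro mult_left_mono) auto
    ultimately have "(int (card K) - 1) * (4 * int (card V))
        \<le> (int (card K) - 1) * ((int (card K) + 1) * int M)"
      by (simp add: algebra_simps)
    then have "4 * int (card V) \<le> (int (card K) + 1) * int M"
      using r by (elim mult_left_le_imp_le) simp
    then have "int (4 * card V) \<le> int ((card K + 1) * M)" by (simp add: algebra_simps)
    then show ?thesis by linarith
  qed
qed

section \<open>Transfer to \<open>max_order\<close> and \<open>min_max_order\<close>\<close>

lemma card_le_max_order: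
  assumes "subgraph_of_complete n V E" "k_connected k V E" "num_colours f E \<le> s"
  shows "card V \<le> max_order f n s k"
proof -
  \<comment> \<open>This bound makes the set of orders finite, as \<open>Max_ge\<close>
    requires.\<close>
  have "card V \<le> n" if "subgraph_of_complete n V E" for V E
    using that card_mono[of "{1..n}" V] by (auto simp: subgraph_of_complete_def)
  then have "{card V | V E. subgraph_of_complete n V E \<and> k_connected k V E \<and> num_colours f E \<le> s}
      \<subseteq> {..n}"
    by auto
  then have "finite {card V | V E.
      subgraph_of_complete n V E \<and> k_connected k V E \<and> num_colours f E \<le> s}"
    using finite_subset by blast
  then show ?thesis
    unfolding max_order_def using assms by (intro Max_ge) auto
qed

lemma min_max_order_attained:
  assumes "r \<ge> 1"
  obtains f where "f \<in> colourings n r" "min_max_order n r s k = max_order f n s k"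
proof -
  have "finite (colourings n r)"
    unfolding colourings_def by (intro finite_PiE finite_all_edges) auto
  moreover have "colourings n r \<noteq> {}"
    using assms by (auto simp: colourings_def PiE_eq_empty_iff)
  ultimately have "min_max_order n r s k \<in> (\<lambda>f. max_order f n s k) ` colourings n r"
    unfolding min_max_order_def by (intro Min_in) auto
  then show ?thesis using that by auto
qed

text \<open>The component with all its edges coloured from \<open>I\<close> is an admissible
  subgraph. Order at least 2 is demanded because \<open>k_connected 1\<close> excludes single
  vertices.\<close>

lemma card_colour_comp_le_max_order:
  assumes "card I = s" "s > 0" "u \<in> {1..n}" "card (colour_comp {1..n} f I u) \<ge> 2"
  shows "card (colour_comp {1..n} f I u) \<le> max_order f n s 1"
proof -
  define W where "W = colour_comp {1..n} f I u"
  define E where "E = {e \<in> all_edges W. f e \<in> I}"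
  have "W \<subseteq> {1..n}"
    using colour_comp_subset[OF assms(3)] by (simp add: W_def)
  then have "subgraph_of_complete n W E" "finite W"
    by (auto simp: subgraph_of_complete_def E_def intro: finite_subset)
  moreover have "k_connected 1 W E"
    using \<open>finite W\<close> assms graph_connected_colour_comp[OF assms(3), of f I]
    unfolding k_connected_1_iff by (simp add: E_def W_def)
  \<comment> \<open>An infinite \<open>I\<close> would have \<open>card\<close> 0, which
    \<open>s > 0\<close> rules out.\<close>
  moreover have "finite I" using assms(1,2) card_gt_0_iff by metis
  then have "card (f ` E) \<le> s"
    using assms(1) by (auto simp: E_def intro!: card_mono)
  ultimately show ?thesis
    unfolding W_def[symmetric] by (intro card_le_max_order) (auto simp: num_colours_def)
qed

theorem theorem3p4:
  fixes n r :: nat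
  assumes "n \<ge> 2" and "r \<ge> 3"
  shows "real (min_max_order n r 2 1) \<ge> 4 * real n / (real r + 1)"
proof -
  obtain f where f: "f \<in> colourings n r" and m: "min_max_order n r 2 1 = max_order f n 2 1"
    using assms(2) min_max_order_attained[of r n 2 1] by auto
  have fK: "f e \<in> {1..r}" if "e \<in> all_edges {1..n}" for e
    using f that by (auto simp: colourings_def)
  \<comment> \<open>The component containing the edge \<open>{1, 2}\<close> shows
    \<open>max_order f n 2 1 \<ge> 2\<close>, so that single-vertex components obey the bound too.
    The colour \<open>d\<close> only serves to make a set of exactly two colours.\<close>
  define c where "c = f {1, 2}"
  define d where "d = c + 1"
  define W where "W = colour_comp {1..n} f {c, d} 1"
  have "{1, 2} \<subseteq> W"
    using assms(1) by (auto simp: W_def c_def intro!: edge_in_colour_comp)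
  moreover have "finite W"
    using colour_comp_subset[of 1 "{1..n}" f "{c, d}"] assms(1)
    by (auto simp: W_def intro: finite_subset)
  ultimately have "2 \<le> card W"
    using card_mono[of W "{1, 2}"] by simp
  moreover from this have "card W \<le> max_order f n 2 1"
    using assms(1) unfolding W_def by (intro card_colour_comp_le_max_order) (auto simp: d_def)
  ultimately have ge2: "2 \<le> max_order f n 2 1" by linarith
  have "card (colour_comp {1..n} f I u) \<le> max_order f n 2 1"
    if "card I = 2" "u \<in> {1..n}" for I u
    using ge2 card_colour_comp_le_max_order[of I 2 u n f] that
    by (cases "card (colour_comp {1..n} f I u) \<ge> 2") auto
  then have "4 * card {1..n} \<le> (card {1..r} + 1) * max_order f n 2 1"
    using assms fK by (intro two_coloured_component_bound[where f = f]) auto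
  then have "4 * n \<le> (r + 1) * max_order f n 2 1" by simp
  then have "real (4 * n) \<le> real ((r + 1) * max_order f n 2 1)"
    by (simp only: of_nat_le_iff)
  then show ?thesis
    unfolding m by (simp add: pos_divide_le_eq algebra_simps)
qed

end
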